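(* Let $y=\mathbf{x}'\beta_0+e$ be a linear regression model, where $\mathbf{x}$ is a random vector in $\mathbb{R}^p$, $\beta_0\in\mathbb{R}^p$, and the error $e$ is independent of $\mathbf{x}$ and is centered and symmetrically distributed with variance $\sigma^2$; let $H_0$ be the joint distribution of $(\mathbf{x},y)$, and let $\lambda\ge0$. Without loss of generality (by ordering the coordinates) let $\beta_{LASSO}(H_0)=((\beta_{LASSO}(H_0))_1,\dots,(\beta_{LASSO}(H_0))_k,0,\dots,0)'$ with $k\le p$ and $(\beta_{LASSO}(H_0))_j\ne0$ for all $j=1,\dots,k$. Then the influence function of the lasso functional is $$IF((\mathbf{x}_0,y_0),\beta_{LASSO},H_0)=\begin{pmatrix}\big(\mathbb{E}_{H_0}[\mathbf{x}_{1:k}\mathbf{x}_{1:k}']\big)^{-1}\Big((\mathbf{x}_0)_{1:k}\big(y_0-\mathbf{x}_0'\beta_{LASSO}(H_0)\big)-\mathbb{E}_{H_0}\big[\mathbf{x}_{1:k}(y-\mathbf{x}'\beta_{LASSO}(H_0))\big]\Big)\\ \mathbf{0}_{p-k}\end{pmatrix}$$ for $\mathbf{x}_0\in\mathbb{R}^p$, $y_0\in\mathbb{R}$.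
   Context: For a joint distribution $H$ of $(\mathbf{x},y)\in\mathbb{R}^p\times\mathbb{R}$, the lasso functional is $$\beta_{LASSO}(H)=\operatorname*{arg\,min}_{\beta\in\mathbb{R}^p}\Big(\mathbb{E}_H\big[(y-\mathbf{x}'\beta)^2\big]+2\lambda\sum_{i=1}^p|\beta_i|\Big).$$ The influence function of a functional $\beta(\cdot)$ at a distribution $H$ is $$IF((\mathbf{x}_0,y_0),\beta,H)=\frac{\partial}{\partial\epsilon}\Big[\beta\big((1-\epsilon)H+\epsilon\,\delta_{(\mathbf{x}_0,y_0)}\big)\Big]\Big|_{\epsilon=0},$$ where $\delta_{(\mathbf{x}_0,y_0)}$ is the point mass at $(\mathbf{x}_0,y_0)$. Notation: $\mathbf{z}_{r:s}=(z_r,z_{r+1},\dots,z_s)'$ for $\mathbf{z}\in\mathbb{R}^p$ and $1\le r\le s\le p$; $\mathbf{0}_{p-k}$ is the zero vector of length $p-k$; a prime on a vector denotes transposition.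
   Formalization: Added: |E[x_j(y − x'β_LASSO(H_0))]| < λ for all j > k (without it the formula fails, e.g. λ = 0, k < p); also the arg min at H_0 is assumed unique, x has finite second moments, and the derivative at ε = 0 is taken from the right. *)

theory Defs
  imports "HOL-Probability.Probability" "Jordan_Normal_Form.Matrix"
begin

no_notation vec_index (infixl \<open>$\<close> 100)
no_notation scalar_prod (infix \<open>\<bullet>\<close> 70)
unbundle inner_syntax

definition contaminate :: "real \<Rightarrow> 'z measure \<Rightarrow> 'z \<Rightarrow> 'z measure" where
  "contaminate \<epsilon> H z =
     measure_of (space H) (sets H)
       (\<lambda>A. ennreal (1 - \<epsilon>) * emeasure H A + ennreal \<epsilon> * emeasure (return H z) A)"

lemma sets_contaminate [simp, measurable_cong]: "sets (contaminate \<epsilon> H z) = sets H"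
  by (simp add: contaminate_def)

lemma emeasure_contaminate:
  assumes "A \<in> sets H"
  shows "emeasure (contaminate \<epsilon> H z) A = ennreal (1 - \<epsilon>) * emeasure H A + ennreal \<epsilon> * indicator A z"
proof -
  have "emeasure (contaminate \<epsilon> H z) A
      = ennreal (1 - \<epsilon>) * emeasure H A + ennreal \<epsilon> * emeasure (return H z) A"
    unfolding contaminate_def
  proof (rule emeasure_measure_of_sigma[OF sets.sigma_algebra_axioms _ _ assms])
    show "positive (sets H)
       (\<lambda>A. ennreal (1 - \<epsilon>) * emeasure H A + ennreal \<epsilon> * emeasure (return H z) A)"
      by (simp add: positive_def)
    show "countably_additive (sets H)
       (\<lambda>A. ennreal (1 - \<epsilon>) * emeasure H A + ennreal \<epsilon> * emeasure (return H z) A)"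
    proof (rule countably_additiveI)
      fix A :: "nat \<Rightarrow> _" assume A: "range A \<subseteq> sets H" "disjoint_family A"
      have "(\<Sum>i. emeasure H (A i)) = emeasure H (\<Union>i. A i)"
        "(\<Sum>i. emeasure (return H z) (A i)) = emeasure (return H z) (\<Union>i. A i)"
        by (rule suminf_emeasure; use A in simp)+
      then show "(\<Sum>i. ennreal (1 - \<epsilon>) * emeasure H (A i) + ennreal \<epsilon> * emeasure (return H z) (A i))
        = ennreal (1 - \<epsilon>) * emeasure H (\<Union>i. A i) + ennreal \<epsilon> * emeasure (return H z) (\<Union>i. A i)"
        by (simp del: emeasure_return add: suminf_add[symmetric] ennreal_suminf_cmult)
    qed
  qed
  with assms show ?thesis by simp
qed

(* The derivative is one-sided: the contaminated model is a probability measure only for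
   \<epsilon> \<in> {0..1}, and functionals are defined on distributions. *)
definition has_influence_function ::
    "('z measure \<Rightarrow> 'v::real_normed_vector) \<Rightarrow> 'z measure \<Rightarrow> 'z \<Rightarrow> 'v \<Rightarrow> bool" where
  "has_influence_function T H z v \<longleftrightarrow>
     ((\<lambda>\<epsilon>. T (contaminate \<epsilon> H z)) has_vector_derivative v) (at 0 within {0..1})"

definition lasso_objective :: "real \<Rightarrow> ((real ^ 'p) \<times> real) measure \<Rightarrow> real ^ 'p \<Rightarrow> real" where
  "lasso_objective lam H \<beta> =
     (\<integral>z. (snd z - fst z \<bullet> \<beta>)\<^sup>2 \<partial>H) + 2 * lam * (\<Sum>i\<in>UNIV. \<bar>\<beta> $ i\<bar>)"

(* If the minimiser is not unique, arg_min picks an arbitrary one. *)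
definition lasso :: "real \<Rightarrow> ((real ^ 'p) \<times> real) measure \<Rightarrow> real ^ 'p" where
  "lasso lam H = arg_min (lasso_objective lam H) (\<lambda>_. True)"

(* Coordinates of a vector in real ^ 'p are ordered by an enumeration c of 'p by {..<CARD('p)},
   so that head c k z is the vector of the first k coordinates and pad c k u is u followed by
   zeros. *)
definition head :: "(nat \<Rightarrow> 'p) \<Rightarrow> nat \<Rightarrow> real ^ 'p \<Rightarrow> real Matrix.vec" where
  "head c k z = Matrix.vec k (\<lambda>i. z $ c i)"

definition pad :: "(nat \<Rightarrow> 'p) \<Rightarrow> nat \<Rightarrow> real Matrix.vec \<Rightarrow> real ^ 'p" where
  "pad c k u = (\<Sum>i<k. vec_index u i *\<^sub>R axis (c i) 1)"

definition head_second_moment ::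
    "(nat \<Rightarrow> 'p) \<Rightarrow> nat \<Rightarrow> ((real ^ 'p) \<times> real) measure \<Rightarrow> real Matrix.mat" where
  "head_second_moment c k H =
     Matrix.mat k k (\<lambda>(i, j). \<integral>z. fst z $ c i * fst z $ c j \<partial>H)"

definition head_score ::
    "(nat \<Rightarrow> 'p) \<Rightarrow> nat \<Rightarrow> ((real ^ 'p) \<times> real) measure \<Rightarrow> real ^ 'p \<Rightarrow> real Matrix.vec" where
  "head_score c k H \<beta> =
     Matrix.vec k (\<lambda>i. \<integral>z. fst z $ c i * (snd z - fst z \<bullet> \<beta>) \<partial>H)"

end

theory Submission
  imports Defs "Jordan_Normal_Form.Determinant"
begin

text \<open>
  Write \<open>g\<close> for the score \<open>E[x (y - x \<bullet> \<beta>)]\<close>, \<open>S\<close> for the second moment matrix \<open>E[x x']\<close> and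
  \<open>r = y\<^sub>0 - x\<^sub>0 \<bullet> \<beta>\<close>. The lasso objective is a convex quadratic plus a multiple of the \<open>\<ell>\<^sub>1\<close> norm, so a
  vector minimises it once the score equals \<open>\<lambda> sgn \<beta>\<^sub>j\<close> at each active coordinate (\<open>\<beta>\<^sub>j \<noteq> 0\<close>) and is at
  most \<open>\<lambda>\<close> in absolute value elsewhere. If the second bound is strict and the quadratic form is
  definite on the active coordinates, the minimiser is unique (\<open>lasso_eqI\<close>).

  Both extra conditions persist under a small contamination. Strictness is an open condition.
  Definiteness follows from uniqueness at the uncontaminated model (\<open>active_definite\<close>): along an
  active null direction of \<open>S\<close> the objective is affine near its minimiser, hence constant. Adding a
  point mass to a definite form leaves it definite. Definiteness also makes the active block of \<open>S\<close>
  invertible.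

  The contaminated minimiser can therefore be written down. With the active signs kept, it is
  \<open>\<beta> + d\<close>, where \<open>d\<close> is supported on the active coordinates and satisfies there
  \<open>(1 - \<epsilon>) S d + \<epsilon> (x\<^sub>0 \<bullet> d) x\<^sub>0 = \<epsilon> (r x\<^sub>0 - g)\<close>. Put \<open>\<eta> = \<epsilon> / (1 - \<epsilon>)\<close> and let \<open>v\<close>, \<open>u\<close> solve
  \<open>S v = r x\<^sub>0 - g\<close> and \<open>S u = x\<^sub>0\<close> on the active block. The Sherman--Morrison formula for the rank one
  update \<open>S + \<eta> x\<^sub>0 x\<^sub>0'\<close> gives
  \<open>d = \<eta> v - (\<eta>\<^sup>2 (x\<^sub>0 \<bullet> v) / (1 + \<eta> (x\<^sub>0 \<bullet> u))) u\<close>.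
  Its derivative at \<open>\<epsilon> = 0\<close> is \<open>v\<close>, the claimed influence function (\<open>lasso_influence\<close>). The
  statement about block matrices is then obtained by translating \<open>v\<close> through \<open>head\<close> and \<open>pad\<close>.
\<close>

no_notation vec_index (infixl \<open>$\<close> 100)
no_notation scalar_prod (infix \<open>\<bullet>\<close> 70)
unbundle inner_syntax

section \<open>Square integrable models: score and second moments\<close>

definition square_integrable_model :: "((real ^ 'p) \<times> real) measure \<Rightarrow> bool" where
  "square_integrable_model H \<longleftrightarrow>
     sets H = sets borel \<and> integrable H (\<lambda>z. (norm (fst z))\<^sup>2) \<and> integrable H (\<lambda>z. (snd z)\<^sup>2)"

definition score :: "((real ^ 'p) \<times> real) measure \<Rightarrow> real ^ 'p \<Rightarrow> real ^ 'p" where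
  "score H b = (\<chi> j. \<integral>z. fst z $ j * (snd z - fst z \<bullet> b) \<partial>H)"

definition second_moment :: "((real ^ 'p) \<times> real) measure \<Rightarrow> real ^ 'p \<Rightarrow> real ^ 'p" where
  "second_moment H d = (\<chi> j. \<integral>z. fst z $ j * (fst z \<bullet> d) \<partial>H)"

lemma measurable_affine:
  fixes a :: "real ^ 'p"
  assumes "sets H = sets borel"
  shows "(\<lambda>z. r * snd z + fst z \<bullet> a) \<in> borel_measurable H"
proof -
  have "(\<lambda>z::(real^'p)\<times>real. r * snd z + fst z \<bullet> a) \<in> borel_measurable borel"
    by (intro borel_measurable_continuous_onI continuous_intros)
  then show ?thesis using assms by (simp cong: measurable_cong_sets)
qed

lemma affine_sq_le:
  fixes X a :: "'v::real_inner"
  shows "(r * s + X \<bullet> a)\<^sup>2 \<le> 2 * r\<^sup>2 * s\<^sup>2 + 2 * (norm a)\<^sup>2 * (norm X)\<^sup>2"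
proof -
  have "(X \<bullet> a)\<^sup>2 \<le> (norm X * norm a)\<^sup>2"
    by (rule abs_le_square_iff[THEN iffD1]) (simp add: Cauchy_Schwarz_ineq2)
  moreover have "(r * s + X \<bullet> a)\<^sup>2 \<le> 2 * (r * s)\<^sup>2 + 2 * (X \<bullet> a)\<^sup>2"
    using sum_squares_bound[of "r * s" "X \<bullet> a"] by (simp add: power2_sum)
  ultimately show ?thesis by (simp add: power_mult_distrib algebra_simps)
qed

lemma integrable_affine_sq:
  fixes a :: "real ^ 'p"
  assumes "square_integrable_model H"
  shows "integrable H (\<lambda>z. (r * snd z + fst z \<bullet> a)\<^sup>2)"
proof (rule Bochner_Integration.integrable_bound)
  show "integrable H (\<lambda>z. 2 * r\<^sup>2 * (snd z)\<^sup>2 + 2 * (norm a)\<^sup>2 * (norm (fst z))\<^sup>2)"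
    using assms by (intro Bochner_Integration.integrable_add integrable_mult_right)
      (auto simp: square_integrable_model_def)
  show "(\<lambda>z. (r * snd z + fst z \<bullet> a)\<^sup>2) \<in> borel_measurable H"
    using assms by (intro borel_measurable_power measurable_affine)
      (simp add: square_integrable_model_def)
  show "AE z in H. norm ((r * snd z + fst z \<bullet> a)\<^sup>2)
      \<le> norm (2 * r\<^sup>2 * (snd z)\<^sup>2 + 2 * (norm a)\<^sup>2 * (norm (fst z))\<^sup>2)"
    using affine_sq_le by (intro AE_I2) auto
qed

text \<open>
  Taking affine functions of \<open>(x, y)\<close> covers coordinates of \<open>x\<close>, inner products \<open>x \<bullet> a\<close> and residuals
  \<open>y - x \<bullet> b\<close> at once; polarisation reduces products to squares.
\<close>

lemma integrable_affine_mult: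
  fixes a a' :: "real ^ 'p"
  assumes "square_integrable_model H"
  shows "integrable H (\<lambda>z. (r * snd z + fst z \<bullet> a) * (r' * snd z + fst z \<bullet> a'))"
proof -
  have "integrable H (\<lambda>z. (((r + r') * snd z + fst z \<bullet> (a + a'))\<^sup>2
      - (r * snd z + fst z \<bullet> a)\<^sup>2 - (r' * snd z + fst z \<bullet> a')\<^sup>2) / 2)"
    using assms by (intro integrable_divide Bochner_Integration.integrable_diff integrable_affine_sq)
  then show ?thesis
    by (rule Bochner_Integration.integrable_cong[THEN iffD1, OF refl, rotated])
      (simp add: power2_eq_square inner_right_distrib field_simps)
qed

lemma integrable_moments:
  fixes a b :: "real ^ 'p"
  assumes "square_integrable_model H"
  shows "integrable H (\<lambda>z. (fst z \<bullet> a) * (fst z \<bullet> b))"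
    and "integrable H (\<lambda>z. fst z $ j * (fst z \<bullet> b))"
    and "integrable H (\<lambda>z. (fst z \<bullet> a)\<^sup>2)"
    and "integrable H (\<lambda>z. (snd z - fst z \<bullet> b)\<^sup>2)"
    and "integrable H (\<lambda>z. (fst z \<bullet> a) * (snd z - fst z \<bullet> b))"
    and "integrable H (\<lambda>z. fst z $ j * (snd z - fst z \<bullet> b))"
  using integrable_affine_mult[OF assms, of 0 a 0 b]
    integrable_affine_mult[OF assms, of 0 "axis j 1" 0 b]
    integrable_affine_mult[OF assms, of 0 a 0 a]
    integrable_affine_mult[OF assms, of 1 "-b" 1 "-b"]
    integrable_affine_mult[OF assms, of 0 a 1 "-b"]
    integrable_affine_mult[OF assms, of 0 "axis j 1" 1 "-b"]
  by (simp_all add: inner_axis power2_eq_square)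

lemma inner_score:
  fixes b h :: "real ^ 'p"
  assumes "square_integrable_model H"
  shows "h \<bullet> score H b = (\<integral>z. (fst z \<bullet> h) * (snd z - fst z \<bullet> b) \<partial>H)"
proof -
  have "(\<integral>z. (fst z \<bullet> h) * (snd z - fst z \<bullet> b) \<partial>H)
      = (\<integral>z. (\<Sum>j\<in>UNIV. h $ j * (fst z $ j * (snd z - fst z \<bullet> b))) \<partial>H)"
    by (rule Bochner_Integration.integral_cong)
      (simp_all only: inner_vec_def[of _ h] sum_distrib_left inner_real_def mult_ac)
  also have "\<dots> = (\<Sum>j\<in>UNIV. h $ j * (\<integral>z. fst z $ j * (snd z - fst z \<bullet> b) \<partial>H))"
    using integrable_moments[OF assms] by (subst Bochner_Integration.integral_sum) auto
  finally show ?thesis by (simp add: score_def inner_vec_def)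
qed

lemma inner_second_moment:
  fixes d h :: "real ^ 'p"
  assumes "square_integrable_model H"
  shows "h \<bullet> second_moment H d = (\<integral>z. (fst z \<bullet> h) * (fst z \<bullet> d) \<partial>H)"
proof -
  have "(\<integral>z. (fst z \<bullet> h) * (fst z \<bullet> d) \<partial>H)
      = (\<integral>z. (\<Sum>j\<in>UNIV. h $ j * (fst z $ j * (fst z \<bullet> d))) \<partial>H)"
    by (rule Bochner_Integration.integral_cong)
      (simp_all only: inner_vec_def[of _ h] sum_distrib_left inner_real_def mult_ac)
  also have "\<dots> = (\<Sum>j\<in>UNIV. h $ j * (\<integral>z. fst z $ j * (fst z \<bullet> d) \<partial>H))"
    using integrable_moments[OF assms] by (subst Bochner_Integration.integral_sum) auto
  finally show ?thesis by (simp add: second_moment_def inner_vec_def)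
qed

lemma linear_second_moment:
  fixes H :: "((real ^ 'p) \<times> real) measure"
  assumes "square_integrable_model H"
  shows "linear (second_moment H)"
  using integrable_moments[OF assms]
  by (intro linearI) (auto simp: second_moment_def Finite_Cartesian_Product.vec_eq_iff
      inner_right_distrib distrib_left mult.left_commute)

lemma score_add:
  fixes b d :: "real ^ 'p"
  assumes "square_integrable_model H"
  shows "score H (b + d) = score H b - second_moment H d"
  using integrable_moments[OF assms]
  by (simp add: score_def second_moment_def Finite_Cartesian_Product.vec_eq_iff
      Bochner_Integration.integral_diff[symmetric] inner_right_distrib right_diff_distrib distrib_left
      diff_diff_eq del: Bochner_Integration.integral_diff)

section \<open>Optimality of lasso solutions\<close>

text \<open>
  The increment of the objective splits into a nonnegative quadratic form and one term per
  coordinate. Both directions of the optimality conditions are read off from this identity.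
\<close>

lemma lasso_objective_add:
  fixes b h :: "real ^ 'p"
  assumes "square_integrable_model H"
  shows "lasso_objective lam H (b + h) = lasso_objective lam H b + (\<integral>z. (fst z \<bullet> h)\<^sup>2 \<partial>H)
    + 2 * (\<Sum>j\<in>UNIV. lam * (\<bar>b $ j + h $ j\<bar> - \<bar>b $ j\<bar>) - h $ j * score H b $ j)"
proof -
  have "(\<integral>z. (snd z - fst z \<bullet> (b + h))\<^sup>2 \<partial>H)
      = (\<integral>z. (snd z - fst z \<bullet> b)\<^sup>2 - 2 * ((fst z \<bullet> h) * (snd z - fst z \<bullet> b)) + (fst z \<bullet> h)\<^sup>2 \<partial>H)"
    by (rule Bochner_Integration.integral_cong)
      (simp_all add: inner_right_distrib power2_eq_square algebra_simps)
  also have "\<dots> = (\<integral>z. (snd z - fst z \<bullet> b)\<^sup>2 \<partial>H) - 2 * (h \<bullet> score H b) + (\<integral>z. (fst z \<bullet> h)\<^sup>2 \<partial>H)"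
    using integrable_moments[OF assms] by (simp add: inner_score[OF assms])
  finally show ?thesis
    by (simp add: lasso_objective_def inner_vec_def sum_subtractf right_diff_distrib
        sum_distrib_left mult.assoc)
qed

text \<open>
  Every increment of the objective away from \<open>b\<close> is a sum of nonnegative terms. A direction that leaves
  \<open>A\<close> is penalised at first order by the strict score bound, and any other direction at second order
  by definiteness on \<open>A\<close>. Hence \<open>b\<close> is the only minimiser, and the choice made in the definition of
  the lasso functional has to select it.
\<close>

lemma lasso_eqI:
  fixes b :: "real ^ 'p"
  assumes H: "square_integrable_model H" and "lam \<ge> 0"
    and active: "\<And>j. j \<in> A \<Longrightarrow> score H b $ j = lam * sgn (b $ j)"
    and inactive: "\<And>j. j \<notin> A \<Longrightarrow> b $ j = 0 \<and> \<bar>score H b $ j\<bar> < lam"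
    and definite: "\<And>h. (\<And>j. j \<notin> A \<Longrightarrow> h $ j = 0) \<Longrightarrow> (\<integral>z. (fst z \<bullet> h)\<^sup>2 \<partial>H) = 0 \<Longrightarrow> h = 0"
  shows "lasso lam H = b"
proof -
  define slack where
    "slack h j = lam * (\<bar>b $ j + h $ j\<bar> - \<bar>b $ j\<bar>) - h $ j * score H b $ j" for h j
  have gap: "lasso_objective lam H (b + h) =
      lasso_objective lam H b + (\<integral>z. (fst z \<bullet> h)\<^sup>2 \<partial>H) + 2 * (\<Sum>j\<in>UNIV. slack h j)" for h
    unfolding slack_def by (rule lasso_objective_add[OF H])
  have quad_nonneg: "(\<integral>z. (fst z \<bullet> h)\<^sup>2 \<partial>H) \<ge> 0" for h by simp
  have inactive_slack: "slack h j \<ge> (lam - \<bar>score H b $ j\<bar>) * \<bar>h $ j\<bar>" if "j \<notin> A" for h j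
    using inactive[OF that] abs_ge_self[of "h $ j * score H b $ j"]
    by (simp add: slack_def abs_mult algebra_simps)
  have slack_nonneg: "slack h j \<ge> 0" for h j
  proof (cases "j \<in> A")
    case True
    have "slack h j = lam * (\<bar>b $ j + h $ j\<bar> - \<bar>b $ j\<bar> - h $ j * sgn (b $ j))"
      by (simp add: slack_def active[OF True] algebra_simps)
    moreover have "\<bar>b $ j + h $ j\<bar> - \<bar>b $ j\<bar> - h $ j * sgn (b $ j) \<ge> 0"
      by (auto simp: sgn_if abs_if)
    ultimately show ?thesis using \<open>lam \<ge> 0\<close> by simp
  next
    case False
    have "(lam - \<bar>score H b $ j\<bar>) * \<bar>h $ j\<bar> \<ge> 0"
      using inactive[OF False] by (intro mult_nonneg_nonneg) auto
    then show ?thesis using inactive_slack[OF False, of h] by linarith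
  qed
  have strict: "lasso_objective lam H b < lasso_objective lam H (b + h)" if "h \<noteq> 0" for h
  proof (cases "\<exists>j. j \<notin> A \<and> h $ j \<noteq> 0")
    case True
    then obtain j where j: "j \<notin> A" "h $ j \<noteq> 0" by blast
    have "0 < (lam - \<bar>score H b $ j\<bar>) * \<bar>h $ j\<bar>" using inactive[OF j(1)] j(2) by simp
    then have "0 < slack h j" using inactive_slack[OF j(1), of h] by linarith
    then have "0 < (\<Sum>j\<in>UNIV. slack h j)"
      using slack_nonneg by (intro sum_pos2[of _ j]) auto
    then show ?thesis using gap[of h] quad_nonneg[of h] by linarith
  next
    case False
    then have "(\<integral>z. (fst z \<bullet> h)\<^sup>2 \<partial>H) \<noteq> 0" using definite[of h] that by blast
    then have "(\<integral>z. (fst z \<bullet> h)\<^sup>2 \<partial>H) > 0"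
      using quad_nonneg[of h] by linarith
    moreover have "0 \<le> (\<Sum>j\<in>UNIV. slack h j)" using slack_nonneg by (intro sum_nonneg)
    ultimately show ?thesis using gap[of h] by linarith
  qed
  have above: "lasso_objective lam H b < lasso_objective lam H b'" if "b' \<noteq> b" for b'
    using strict[of "b' - b"] that by simp
  show ?thesis
    unfolding lasso_def
  proof (rule arg_minI[of "\<lambda>_. True" b])
    show "\<not> lasso_objective lam H b' < lasso_objective lam H b" for b'
      using above[of b'] by (cases "b' = b") auto
    show "b' = b" if "\<forall>y. True \<longrightarrow> \<not> lasso_objective lam H y < lasso_objective lam H b'" for b'
      using above[of b'] that by blast
  qed simp
qed

lemma abs_add_small:
  fixes s t :: real
  assumes "\<bar>t\<bar> < \<bar>s\<bar>"
  shows "\<bar>s + t\<bar> = \<bar>s\<bar> + t * sgn s"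
  using assms by (auto simp: sgn_if abs_if split: if_splits)

text \<open>
  Moving an active coordinate by less than its modulus does not change its sign, so the objective is a
  parabola there, with vanishing derivative at the minimiser.
\<close>

lemma score_active:
  fixes b :: "real ^ 'p"
  assumes H: "square_integrable_model H"
    and min: "\<And>b'. lasso_objective lam H b \<le> lasso_objective lam H b'"
    and "b $ j \<noteq> 0"
  shows "score H b $ j = lam * sgn (b $ j)"
proof -
  define q where "q = (\<integral>z. (fst z $ j)\<^sup>2 \<partial>H)"
  define D where "D = 2 * (lam * sgn (b $ j) - score H b $ j)"
  have parabola: "0 \<le> t\<^sup>2 * q + t * D" if "\<bar>t\<bar> < \<bar>b $ j\<bar>" for t
  proof -
    let ?h = "t *\<^sub>R axis j (1::real) :: real ^ 'p"
    have "(\<Sum>i\<in>UNIV. lam * (\<bar>b $ i + ?h $ i\<bar> - \<bar>b $ i\<bar>) - ?h $ i * score H b $ i)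
        = (\<Sum>i\<in>UNIV. if i = j then t * (D / 2) else 0)"
      by (rule sum.cong) (auto simp: axis_def abs_add_small[OF that] D_def right_diff_distrib distrib_left)
    moreover have "(\<integral>z. (fst z \<bullet> ?h)\<^sup>2 \<partial>H) = t\<^sup>2 * q"
      by (simp add: inner_axis power_mult_distrib q_def)
    ultimately show ?thesis
      using lasso_objective_add[OF H, of lam b ?h] min[of "b + ?h"] by simp
  qed
  have "((\<lambda>t. t\<^sup>2 * q + t * D) has_real_derivative D) (at 0)"
    by (auto intro!: derivative_eq_intros)
  then have "D = 0"
    by (rule DERIV_local_min[of _ _ _ "\<bar>b $ j\<bar>"]) (use \<open>b $ j \<noteq> 0\<close> parabola in auto)
  then show ?thesis by (simp add: D_def)
qed

text \<open>
  A short step along an active null direction keeps all signs, so the first order terms cancel by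
  \<open>score_active\<close>, and the quadratic term is zero: the new point is a second minimiser.
\<close>

lemma active_definite:
  fixes b h :: "real ^ 'p"
  assumes H: "square_integrable_model H"
    and min: "\<And>b'. lasso_objective lam H b \<le> lasso_objective lam H b'"
    and unique: "\<And>b'. lasso_objective lam H b' = lasso_objective lam H b \<Longrightarrow> b' = b"
    and supp: "\<And>j. b $ j = 0 \<Longrightarrow> h $ j = 0"
    and null: "(\<integral>z. (fst z \<bullet> h)\<^sup>2 \<partial>H) = 0"
  shows "h = 0"
proof -
  \<comment> \<open>A step length short enough to preserve the sign of every active coordinate.\<close>
  have "\<forall>\<^sub>F t in at_right 0. \<forall>j. b $ j \<noteq> 0 \<longrightarrow> \<bar>t * h $ j\<bar> < \<bar>b $ j\<bar>"
  proof (intro eventually_all_finite)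
    fix j
    have "((\<lambda>t. \<bar>t * h $ j\<bar>) \<longlongrightarrow> \<bar>0 * h $ j\<bar>) (at_right 0)"
      by (intro tendsto_intros)
    from order_tendstoD(2)[OF this, of "\<bar>b $ j\<bar>"]
    show "\<forall>\<^sub>F t in at_right 0. b $ j \<noteq> 0 \<longrightarrow> \<bar>t * h $ j\<bar> < \<bar>b $ j\<bar>"
      by (cases "b $ j = 0") auto
  qed
  then obtain t :: real where "t > 0" and t: "\<And>j. b $ j \<noteq> 0 \<Longrightarrow> \<bar>t * h $ j\<bar> < \<bar>b $ j\<bar>"
    using eventually_happens'[OF trivial_limit_at_right_real eventually_conj[OF _ eventually_at_right_less]]
    by (metis (mono_tags, lifting))
  have "lam * (\<bar>b $ j + (t *\<^sub>R h) $ j\<bar> - \<bar>b $ j\<bar>) - (t *\<^sub>R h) $ j * score H b $ j = 0" for j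
  proof (cases "b $ j = 0")
    case True
    then show ?thesis by (simp add: supp)
  next
    case False
    then show ?thesis
      using score_active[OF H min False] abs_add_small[OF t[OF False]] by simp
  qed
  moreover have "(\<integral>z. (fst z \<bullet> (t *\<^sub>R h))\<^sup>2 \<partial>H) = 0"
    using null by (simp add: power_mult_distrib)
  ultimately have "lasso_objective lam H (b + t *\<^sub>R h) = lasso_objective lam H b"
    by (simp add: lasso_objective_add[OF H])
  then show "h = 0" using unique[of "b + t *\<^sub>R h"] \<open>t > 0\<close> by simp
qed

section \<open>Integration against a contaminated distribution\<close>

lemma nn_integral_contaminate:
  assumes "f \<in> borel_measurable H" and "z \<in> space H"
  shows "(\<integral>\<^sup>+w. f w \<partial>contaminate \<epsilon> H z) = ennreal (1 - \<epsilon>) * (\<integral>\<^sup>+w. f w \<partial>H) + ennreal \<epsilon> * f z"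
  using assms(1)
proof (induction rule: borel_measurable_induct)
  case (cong f g)
  have "space (contaminate \<epsilon> H z) = space H"
    by (rule sets_eq_imp_space_eq) simp
  with cong have "(\<integral>\<^sup>+w. f w \<partial>contaminate \<epsilon> H z) = (\<integral>\<^sup>+w. g w \<partial>contaminate \<epsilon> H z)"
    by (intro nn_integral_cong) auto
  moreover have "(\<integral>\<^sup>+w. f w \<partial>H) = (\<integral>\<^sup>+w. g w \<partial>H)"
    using cong by (intro nn_integral_cong) auto
  ultimately show ?case
    using cong \<open>z \<in> space H\<close> by simp
next
  case (set A)
  then show ?case by (simp add: emeasure_contaminate)
next
  case (mult u c)
  moreover have "u \<in> borel_measurable (contaminate \<epsilon> H z)" using mult by simp
  ultimately show ?case by (simp add: nn_integral_cmult algebra_simps)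
next
  case (add u v)
  moreover have "u \<in> borel_measurable (contaminate \<epsilon> H z)" "v \<in> borel_measurable (contaminate \<epsilon> H z)"
    using add by simp_all
  ultimately show ?case by (simp add: nn_integral_add algebra_simps)
next
  case (seq U)
  have "U i \<in> borel_measurable (contaminate \<epsilon> H z)" for i using seq by simp
  then have "(\<integral>\<^sup>+w. (SUP i. U i w) \<partial>contaminate \<epsilon> H z) = (SUP i. \<integral>\<^sup>+w. U i w \<partial>contaminate \<epsilon> H z)"
    using seq by (simp add: nn_integral_monotone_convergence_SUP)
  also have "\<dots> = (SUP i. ennreal (1 - \<epsilon>) * (\<integral>\<^sup>+w. U i w \<partial>H) + ennreal \<epsilon> * U i z)"
    using seq by simp
  also have "\<dots> = (SUP i. ennreal (1 - \<epsilon>) * (\<integral>\<^sup>+w. U i w \<partial>H)) + (SUP i. ennreal \<epsilon> * U i z)"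
    by (rule ennreal_SUP_add)
      (use \<open>incseq U\<close> in \<open>auto simp: incseq_def le_fun_def intro!: mult_left_mono nn_integral_mono\<close>)
  also have "\<dots> = ennreal (1 - \<epsilon>) * (\<integral>\<^sup>+w. (SUP i. U i w) \<partial>H) + ennreal \<epsilon> * (SUP i. U i z)"
    using seq by (simp add: nn_integral_monotone_convergence_SUP SUP_mult_left_ennreal)
  finally show ?case by (simp add: image_comp)
qed

text \<open>The formula for nonnegative functions extends to \<open>f\<close> through its positive and negative parts.\<close>

lemma has_bochner_integral_contaminate:
  fixes f :: "'z \<Rightarrow> real"
  assumes f: "integrable H f" and z: "z \<in> space H" and \<epsilon>: "0 \<le> \<epsilon>" "\<epsilon> \<le> 1"
  shows "has_bochner_integral (contaminate \<epsilon> H z) f ((1 - \<epsilon>) * (\<integral>w. f w \<partial>H) + \<epsilon> * f z)"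
proof -
  have nonneg: "has_bochner_integral (contaminate \<epsilon> H z) g ((1 - \<epsilon>) * (\<integral>w. g w \<partial>H) + \<epsilon> * g z)"
    if "integrable H g" "\<And>w. g w \<ge> 0" for g :: "'z \<Rightarrow> real"
  proof (rule has_bochner_integral_nn_integral)
    show "g \<in> borel_measurable (contaminate \<epsilon> H z)" using that(1) by simp
    have "(\<integral>\<^sup>+w. ennreal (g w) \<partial>H) = ennreal (\<integral>w. g w \<partial>H)"
      using that by (intro nn_integral_eq_integral) auto
    then show "(\<integral>\<^sup>+w. ennreal (g w) \<partial>contaminate \<epsilon> H z)
        = ennreal ((1 - \<epsilon>) * (\<integral>w. g w \<partial>H) + \<epsilon> * g z)"
      using that z \<epsilon> by (simp add: nn_integral_contaminate ennreal_mult ennreal_plus)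
  qed (use that \<epsilon> in auto)
  have "has_bochner_integral (contaminate \<epsilon> H z) (\<lambda>w. max 0 (f w) - max 0 (- f w))
      ((1 - \<epsilon>) * (\<integral>w. max 0 (f w) \<partial>H) + \<epsilon> * max 0 (f z)
        - ((1 - \<epsilon>) * (\<integral>w. max 0 (- f w) \<partial>H) + \<epsilon> * max 0 (- f z)))"
    using f by (intro has_bochner_integral_diff nonneg) auto
  moreover have parts: "max 0 r - max 0 (- r) = r" for r :: real by auto
  moreover have "(\<integral>w. f w \<partial>H) = (\<integral>w. max 0 (f w) \<partial>H) - (\<integral>w. max 0 (- f w) \<partial>H)"
    using f by (simp flip: Bochner_Integration.integral_diff add: parts)
  moreover have "(1 - \<epsilon>) * P + \<epsilon> * s - ((1 - \<epsilon>) * N + \<epsilon> * t) = (1 - \<epsilon>) * (P - N) + \<epsilon> * (s - t)"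
    for P N s t by (simp add: algebra_simps)
  ultimately show ?thesis by (simp only: parts)
qed

lemmas integrable_contaminate = has_bochner_integral_contaminate[THEN integrable.intros]
  and integral_contaminate = has_bochner_integral_contaminate[THEN has_bochner_integral_integral_eq]

lemma square_integrable_model_contaminate:
  fixes H :: "((real ^ 'p) \<times> real) measure"
  assumes H: "square_integrable_model H" and "0 \<le> \<epsilon>" "\<epsilon> \<le> 1"
  shows "square_integrable_model (contaminate \<epsilon> H z)"
proof -
  have "z \<in> space H"
    using H sets_eq_imp_space_eq[of H borel] by (auto simp: square_integrable_model_def)
  with assms show ?thesis
    by (auto simp: square_integrable_model_def intro!: integrable_contaminate)
qed

lemma score_contaminate:
  fixes b x\<^sub>0 :: "real ^ 'p"
  assumes H: "square_integrable_model H" and \<epsilon>: "0 \<le> \<epsilon>" "\<epsilon> \<le> 1"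
  shows "score (contaminate \<epsilon> H (x\<^sub>0, y\<^sub>0)) b = (1 - \<epsilon>) *\<^sub>R score H b + (\<epsilon> * (y\<^sub>0 - x\<^sub>0 \<bullet> b)) *\<^sub>R x\<^sub>0"
proof -
  have "(x\<^sub>0, y\<^sub>0) \<in> space H"
    using H sets_eq_imp_space_eq[of H borel] by (auto simp: square_integrable_model_def)
  then show ?thesis
    using integrable_moments[OF H] \<epsilon>
    by (simp add: score_def Finite_Cartesian_Product.vec_eq_iff integral_contaminate)
qed

text \<open>
  Both parts of the contaminated quadratic form are nonnegative, so they vanish together. This needs
  \<open>\<epsilon> < 1\<close>, since a point mass alone is degenerate.
\<close>

lemma null_direction_contaminate:
  fixes h x\<^sub>0 :: "real ^ 'p"
  assumes H: "square_integrable_model H" and \<epsilon>: "0 \<le> \<epsilon>" "\<epsilon> < 1"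
    and null: "(\<integral>z. (fst z \<bullet> h)\<^sup>2 \<partial>contaminate \<epsilon> H (x\<^sub>0, y\<^sub>0)) = 0"
  shows "(\<integral>z. (fst z \<bullet> h)\<^sup>2 \<partial>H) = 0"
proof -
  have "(x\<^sub>0, y\<^sub>0) \<in> space H"
    using H sets_eq_imp_space_eq[of H borel] by (auto simp: square_integrable_model_def)
  then have "(1 - \<epsilon>) * (\<integral>z. (fst z \<bullet> h)\<^sup>2 \<partial>H) + \<epsilon> * (x\<^sub>0 \<bullet> h)\<^sup>2 = 0"
    using null integrable_moments[OF H] \<epsilon> by (simp add: integral_contaminate)
  moreover have "(1 - \<epsilon>) * (\<integral>z. (fst z \<bullet> h)\<^sup>2 \<partial>H) \<ge> 0" "\<epsilon> * (x\<^sub>0 \<bullet> h)\<^sup>2 \<ge> 0"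
    using \<epsilon> by auto
  ultimately have "(1 - \<epsilon>) * (\<integral>z. (fst z \<bullet> h)\<^sup>2 \<partial>H) = 0" by linarith
  then show ?thesis using \<epsilon> by simp
qed

section \<open>The lasso along the contamination path\<close>

text \<open>
  For \<open>\<epsilon> \<ge> 0\<close> the left side is the contaminated score at \<open>b + (\<eta> v - w u)\<close>, by \<open>score_contaminate\<close>.
  Keeping it equal to its value at \<open>\<epsilon> = 0\<close> amounts to \<open>(S + \<eta> x\<^sub>0 x\<^sub>0') d = \<eta> (r x\<^sub>0 - g)\<close>, and \<open>w\<close> is the
  Sherman--Morrison coefficient that solves this.
\<close>

lemma score_constant_along_path:
  fixes b u v x\<^sub>0 :: "real ^ 'p" and y\<^sub>0 \<epsilon> :: real
  defines "\<eta> \<equiv> \<epsilon> / (1 - \<epsilon>)"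
  defines "w \<equiv> \<eta>\<^sup>2 * (x\<^sub>0 \<bullet> v) / (1 + \<eta> * (x\<^sub>0 \<bullet> u))"
  assumes H: "square_integrable_model H" and \<epsilon>: "\<epsilon> < 1" and denom: "1 + \<eta> * (x\<^sub>0 \<bullet> u) \<noteq> 0"
    and Sv: "second_moment H v $ j = (y\<^sub>0 - x\<^sub>0 \<bullet> b) * x\<^sub>0 $ j - score H b $ j"
    and Su: "second_moment H u $ j = x\<^sub>0 $ j"
  shows "((1 - \<epsilon>) *\<^sub>R score H (b + (\<eta> *\<^sub>R v - w *\<^sub>R u))
      + (\<epsilon> * (y\<^sub>0 - x\<^sub>0 \<bullet> (b + (\<eta> *\<^sub>R v - w *\<^sub>R u)))) *\<^sub>R x\<^sub>0) $ j = score H b $ j"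
proof -
  let ?r = "y\<^sub>0 - x\<^sub>0 \<bullet> b" and ?g = "score H b $ j" and ?X = "x\<^sub>0 $ j"
  have \<eta>: "(1 - \<epsilon>) * \<eta> = \<epsilon>" using \<epsilon> by (simp add: \<eta>_def)
  \<comment> \<open>The fixed point equation of \<open>w\<close>: its right side is \<open>\<eta> (x\<^sub>0 \<bullet> d)\<close> for the displacement \<open>d\<close>.\<close>
  have w: "w = \<eta> * (\<eta> * (x\<^sub>0 \<bullet> v) - w * (x\<^sub>0 \<bullet> u))"
    using denom by (simp add: w_def field_simps power2_eq_square)
  have "second_moment H (\<eta> *\<^sub>R v - w *\<^sub>R u) $ j = \<eta> * (?r * ?X - ?g) - w * ?X"
    using linear_second_moment[OF H] by (simp add: linear_diff linear_scale Sv Su)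
  moreover have "y\<^sub>0 - x\<^sub>0 \<bullet> (b + (\<eta> *\<^sub>R v - w *\<^sub>R u)) = ?r - (\<eta> * (x\<^sub>0 \<bullet> v) - w * (x\<^sub>0 \<bullet> u))"
    by (simp add: inner_right_distrib inner_diff_right)
  ultimately have "((1 - \<epsilon>) *\<^sub>R score H (b + (\<eta> *\<^sub>R v - w *\<^sub>R u))
      + (\<epsilon> * (y\<^sub>0 - x\<^sub>0 \<bullet> (b + (\<eta> *\<^sub>R v - w *\<^sub>R u)))) *\<^sub>R x\<^sub>0) $ j
      = (1 - \<epsilon>) * (?g - (\<eta> * (?r * ?X - ?g) - w * ?X))
        + \<epsilon> * (?r - (\<eta> * (x\<^sub>0 \<bullet> v) - w * (x\<^sub>0 \<bullet> u))) * ?X"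
    by (simp add: score_add[OF H])
  also have "\<dots> = (1 - \<epsilon>) * (?g - (\<eta> * (?r * ?X - ?g) - w * ?X))
        + (1 - \<epsilon>) * \<eta> * (?r - (\<eta> * (x\<^sub>0 \<bullet> v) - w * (x\<^sub>0 \<bullet> u))) * ?X"
    by (simp only: \<eta>)
  also have "\<dots> = (1 - \<epsilon>) * ?g + ((1 - \<epsilon>) * \<eta>) * ?g
        + (1 - \<epsilon>) * ?X * (w - \<eta> * (\<eta> * (x\<^sub>0 \<bullet> v) - w * (x\<^sub>0 \<bullet> u)))"
    by (simp add: algebra_simps)
  also have "\<dots> = ?g"
    unfolding \<eta> using w by (simp add: algebra_simps)
  finally show ?thesis .
qed

text \<open>
  The path \<open>b + d \<epsilon>\<close> keeps the contaminated scores constant at active coordinates. Near \<open>\<epsilon> = 0\<close> it also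
  keeps the active signs and the strict bound at the inactive coordinates, so \<open>lasso_eqI\<close> identifies it with the lasso of the
  contaminated model. As \<open>\<eta>\<close> has derivative 1 and \<open>w\<close>, of order \<open>\<eta>\<^sup>2\<close>, has derivative 0, the path has
  velocity \<open>v\<close>.
\<close>

lemma lasso_influence:
  fixes b u v x\<^sub>0 :: "real ^ 'p"
  assumes H: "square_integrable_model H" and lam: "lam \<ge> 0"
    and min: "\<And>b'. lasso_objective lam H b \<le> lasso_objective lam H b'"
    and unique: "\<And>b'. lasso_objective lam H b' = lasso_objective lam H b \<Longrightarrow> b' = b"
    and strict: "\<And>j. b $ j = 0 \<Longrightarrow> \<bar>score H b $ j\<bar> < lam"
    and supp: "\<And>j. b $ j = 0 \<Longrightarrow> v $ j = 0" "\<And>j. b $ j = 0 \<Longrightarrow> u $ j = 0"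
    and Sv: "\<And>j. b $ j \<noteq> 0 \<Longrightarrow> second_moment H v $ j = (y\<^sub>0 - x\<^sub>0 \<bullet> b) * x\<^sub>0 $ j - score H b $ j"
    and Su: "\<And>j. b $ j \<noteq> 0 \<Longrightarrow> second_moment H u $ j = x\<^sub>0 $ j"
  shows "has_influence_function (lasso lam) H (x\<^sub>0, y\<^sub>0) v"
proof -
  define \<eta> :: "real \<Rightarrow> real" where "\<eta> \<epsilon> = \<epsilon> / (1 - \<epsilon>)" for \<epsilon>
  define w where "w \<epsilon> = (\<eta> \<epsilon>)\<^sup>2 * (x\<^sub>0 \<bullet> v) / (1 + \<eta> \<epsilon> * (x\<^sub>0 \<bullet> u))" for \<epsilon>
  define d where "d \<epsilon> = \<eta> \<epsilon> *\<^sub>R v - w \<epsilon> *\<^sub>R u" for \<epsilon>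
  define sc where
    "sc \<epsilon> = (1 - \<epsilon>) *\<^sub>R score H (b + d \<epsilon>) + (\<epsilon> * (y\<^sub>0 - x\<^sub>0 \<bullet> (b + d \<epsilon>))) *\<^sub>R x\<^sub>0" for \<epsilon>
  have "\<eta> 0 = 0" by (simp add: \<eta>_def)
  have \<eta>': "(\<eta> has_real_derivative 1) (at 0)"
    unfolding \<eta>_def by (auto intro!: derivative_eq_intros)
  have w': "(w has_real_derivative 0) (at 0)"
    unfolding w_def by (auto intro!: derivative_eq_intros \<eta>' simp: \<open>\<eta> 0 = 0\<close>)
  have d': "(d has_vector_derivative v) (at 0)"
    using has_vector_derivative_diff[OF
        has_vector_derivative_scaleR[OF \<eta>' has_vector_derivative_const]
        has_vector_derivative_scaleR[OF w' has_vector_derivative_const], of v u]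
    by (simp add: d_def[abs_def])
  have "d 0 = 0" by (simp add: d_def w_def \<eta>_def)
  \<comment> \<open>Limits along \<open>nhds 0\<close> rather than \<open>at 0\<close>: the path has to agree with the lasso at \<open>\<epsilon> = 0\<close> as well.\<close>
  have "(d \<longlongrightarrow> d 0) (nhds 0)"
    using has_vector_derivative_continuous[OF d']
    by (simp only: continuous_at tendsto_at_iff_tendsto_nhds)
  then have d_lim: "(d \<longlongrightarrow> 0) (nhds 0)" by (simp only: \<open>d 0 = 0\<close>)
  have "((\<lambda>\<epsilon>. second_moment H (d \<epsilon>)) \<longlongrightarrow> second_moment H 0) (nhds 0)"
    using linear_second_moment[OF H]
    by (intro bounded_linear.tendsto[OF _ d_lim]) (simp add: linear_conv_bounded_linear)
  then have S_lim: "((\<lambda>\<epsilon>. second_moment H (d \<epsilon>)) \<longlongrightarrow> 0) (nhds 0)"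
    by (simp add: linear_0[OF linear_second_moment[OF H]])
  have id_lim: "((\<lambda>\<epsilon>::real. \<epsilon>) \<longlongrightarrow> 0) (nhds 0)" by (rule filterlim_ident)
  have "(sc \<longlongrightarrow> (1 - 0) *\<^sub>R (score H b - 0) + (0 * (y\<^sub>0 - x\<^sub>0 \<bullet> (b + 0))) *\<^sub>R x\<^sub>0) (nhds 0)"
    unfolding sc_def score_add[OF H] by (intro tendsto_intros d_lim S_lim id_lim)
  then have sc_lim: "(sc \<longlongrightarrow> score H b) (nhds 0)" by simp
  have near_active: "\<forall>\<^sub>F \<epsilon> in nhds 0. b $ j \<noteq> 0 \<longrightarrow> \<bar>d \<epsilon> $ j\<bar> < \<bar>b $ j\<bar>" for j
  proof -
    have "((\<lambda>\<epsilon>. \<bar>d \<epsilon> $ j\<bar>) \<longlongrightarrow> \<bar>(0 :: real ^ 'p) $ j\<bar>) (nhds 0)" by (intro tendsto_intros d_lim)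
    from order_tendstoD(2)[OF this, of "\<bar>b $ j\<bar>"] show ?thesis by (cases "b $ j = 0") auto
  qed
  have near_inactive: "\<forall>\<^sub>F \<epsilon> in nhds 0. b $ j = 0 \<longrightarrow> \<bar>sc \<epsilon> $ j\<bar> < lam" for j
  proof -
    have "((\<lambda>\<epsilon>. \<bar>sc \<epsilon> $ j\<bar>) \<longlongrightarrow> \<bar>score H b $ j\<bar>) (nhds 0)" by (intro tendsto_intros sc_lim)
    from order_tendstoD(2)[OF this, of lam] strict[of j] show ?thesis by (cases "b $ j = 0") auto
  qed
  have "(\<eta> \<longlongrightarrow> \<eta> 0) (nhds 0)"
    using DERIV_isCont[OF \<eta>'] by (simp only: isCont_def tendsto_at_iff_tendsto_nhds)
  then have "(\<eta> \<longlongrightarrow> 0) (nhds 0)" by (simp only: \<open>\<eta> 0 = 0\<close>)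
  then have "((\<lambda>\<epsilon>. 1 + \<eta> \<epsilon> * (x\<^sub>0 \<bullet> u)) \<longlongrightarrow> 1 + 0 * (x\<^sub>0 \<bullet> u)) (nhds 0)"
    by (intro tendsto_intros)
  then have near_denom: "\<forall>\<^sub>F \<epsilon> in nhds 0. 1 + \<eta> \<epsilon> * (x\<^sub>0 \<bullet> u) \<noteq> 0"
    by (rule tendsto_imp_eventually_ne) simp
  have "\<forall>\<^sub>F \<epsilon> in nhds (0::real). \<epsilon> < 1" by (rule order_tendstoD(2)[OF id_lim]) simp
  then have "\<forall>\<^sub>F \<epsilon> in nhds 0. \<epsilon> < 1 \<and> 1 + \<eta> \<epsilon> * (x\<^sub>0 \<bullet> u) \<noteq> 0 \<and>
      (\<forall>j. b $ j \<noteq> 0 \<longrightarrow> \<bar>d \<epsilon> $ j\<bar> < \<bar>b $ j\<bar>) \<and> (\<forall>j. b $ j = 0 \<longrightarrow> \<bar>sc \<epsilon> $ j\<bar> < lam)"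
    by (intro eventually_conj near_denom eventually_all_finite near_active near_inactive)
  then obtain \<delta> where "\<delta> > 0" and near: "\<And>\<epsilon>. dist \<epsilon> 0 < \<delta> \<Longrightarrow> \<epsilon> < 1 \<and> 1 + \<eta> \<epsilon> * (x\<^sub>0 \<bullet> u) \<noteq> 0 \<and>
      (\<forall>j. b $ j \<noteq> 0 \<longrightarrow> \<bar>d \<epsilon> $ j\<bar> < \<bar>b $ j\<bar>) \<and> (\<forall>j. b $ j = 0 \<longrightarrow> \<bar>sc \<epsilon> $ j\<bar> < lam)"
    unfolding eventually_nhds_metric by blast
  have path: "lasso lam (contaminate \<epsilon> H (x\<^sub>0, y\<^sub>0)) = b + d \<epsilon>"
    if "\<epsilon> \<in> {0..1}" "dist \<epsilon> 0 < \<delta>" for \<epsilon>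
  proof -
    from that(1) have \<epsilon>: "0 \<le> \<epsilon>" "\<epsilon> \<le> 1" by auto
    from near[OF that(2)] have "\<epsilon> < 1" and denom: "1 + \<eta> \<epsilon> * (x\<^sub>0 \<bullet> u) \<noteq> 0"
      and act: "\<And>j. b $ j \<noteq> 0 \<Longrightarrow> \<bar>d \<epsilon> $ j\<bar> < \<bar>b $ j\<bar>"
      and inact: "\<And>j. b $ j = 0 \<Longrightarrow> \<bar>sc \<epsilon> $ j\<bar> < lam"
      by blast+
    have sc: "score (contaminate \<epsilon> H (x\<^sub>0, y\<^sub>0)) (b + d \<epsilon>) = sc \<epsilon>"
      by (simp only: score_contaminate[OF H \<epsilon>] sc_def)
    show ?thesis
    proof (rule lasso_eqI[where A = "{j. b $ j \<noteq> 0}"])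
      show "square_integrable_model (contaminate \<epsilon> H (x\<^sub>0, y\<^sub>0))"
        by (rule square_integrable_model_contaminate[OF H \<epsilon>])
      show "score (contaminate \<epsilon> H (x\<^sub>0, y\<^sub>0)) (b + d \<epsilon>) $ j = lam * sgn ((b + d \<epsilon>) $ j)"
        if "j \<in> {j. b $ j \<noteq> 0}" for j
      proof -
        from that have j: "b $ j \<noteq> 0" by simp
        have "sc \<epsilon> $ j = score H b $ j"
          unfolding sc_def d_def w_def \<eta>_def
          by (rule score_constant_along_path[OF H \<open>\<epsilon> < 1\<close> denom[unfolded \<eta>_def] Sv[OF j] Su[OF j]])
        moreover have "sgn ((b + d \<epsilon>) $ j) = sgn (b $ j)"
          using act[OF j] by (auto simp: sgn_if)
        ultimately show ?thesis by (simp add: sc score_active[OF H min j])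
      qed
      show "(b + d \<epsilon>) $ j = 0 \<and> \<bar>score (contaminate \<epsilon> H (x\<^sub>0, y\<^sub>0)) (b + d \<epsilon>) $ j\<bar> < lam"
        if "j \<notin> {j. b $ j \<noteq> 0}" for j
        using that inact[of j] supp[of j] unfolding sc by (simp add: d_def)
      show "h = 0" if "\<And>j. j \<notin> {j. b $ j \<noteq> 0} \<Longrightarrow> h $ j = 0"
        "(\<integral>z. (fst z \<bullet> h)\<^sup>2 \<partial>contaminate \<epsilon> H (x\<^sub>0, y\<^sub>0)) = 0" for h
        using null_direction_contaminate[OF H \<epsilon>(1) \<open>\<epsilon> < 1\<close> that(2)] that(1)
        by (intro active_definite[OF H min unique, of h]) auto
    qed (rule lam)
  qed
  have "((\<lambda>\<epsilon>. b + d \<epsilon>) has_vector_derivative v) (at 0 within {0..1})"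
    using has_vector_derivative_add[OF has_vector_derivative_const has_vector_derivative_at_within[OF d']]
    by simp
  then show ?thesis
    unfolding has_influence_function_def
    by (rule has_vector_derivative_transform_within[OF _ \<open>\<delta> > 0\<close>]) (auto simp: path)
qed

section \<open>Block matrices on the leading coordinates\<close>

lemma pad_nth:
  fixes c :: "nat \<Rightarrow> 'p::finite"
  assumes c: "bij_betw c {..<CARD('p)} UNIV" and k: "k \<le> CARD('p)" and j: "j < CARD('p)"
  shows "pad c k w $ c j = (if j < k then vec_index w j else 0)"
proof -
  have "c j = c i \<longleftrightarrow> i = j" if "i < k" for i
    using bij_betw_imp_inj_on[OF c] that k j by (auto simp: inj_on_def)
  then have "pad c k w $ c j = (\<Sum>i<k. if i = j then vec_index w i else 0)"
    unfolding pad_def sum_component by (intro sum.cong) (auto simp: axis_def)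
  then show ?thesis by simp
qed

text \<open>
  On vectors supported by the leading coordinates, the leading block of \<open>S\<close> acts as \<open>S\<close> itself,
  so the equations \<open>S v = r x\<^sub>0 - g\<close> and \<open>S u = x\<^sub>0\<close> at the active coordinates become square linear systems.
\<close>

lemma second_moment_pad:
  fixes c :: "nat \<Rightarrow> 'p::finite"
  assumes H: "square_integrable_model H" and i: "i < k" and w: "w \<in> carrier_vec k"
  shows "second_moment H (pad c k w) $ c i = vec_index (head_second_moment c k H *\<^sub>v w) i"
proof -
  have "second_moment H (pad c k w) = (\<Sum>l<k. vec_index w l *\<^sub>R second_moment H (axis (c l) 1))"
    using linear_second_moment[OF H] by (simp add: pad_def linear_sum linear_scale)
  then have "second_moment H (pad c k w) $ c i
      = (\<Sum>l<k. vec_index w l * (\<integral>z. fst z $ c i * fst z $ c l \<partial>H))"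
    by (simp add: second_moment_def inner_axis)
  also have "\<dots> = vec_index (head_second_moment c k H *\<^sub>v w) i"
    using i w by (simp add: head_second_moment_def scalar_prod_def lessThan_atLeast0 mult.commute)
  finally show ?thesis .
qed

lemma inverts_mat_of_trivial_kernel:
  fixes A :: "'a::field Matrix.mat"
  assumes A: "A \<in> carrier_mat n n"
    and ker: "\<And>w. w \<in> carrier_vec n \<Longrightarrow> A *\<^sub>v w = 0\<^sub>v n \<Longrightarrow> w = 0\<^sub>v n"
  obtains B where "B \<in> carrier_mat n n" "inverts_mat A B" "inverts_mat B A"
proof -
  have "Determinant.det A \<noteq> 0" using det_0_iff_vec_prod_zero_field[OF A] ker by blast
  from det_non_zero_imp_unit[OF A this, of "()"] obtain B where
    "B \<in> carrier_mat n n" "A * B = 1\<^sub>m n" "B * A = 1\<^sub>m n"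
    by (auto simp: Units_def ring_mat_simps)
  with A that show thesis by (auto simp: inverts_mat_def)
qed

section \<open>The influence function of the lasso\<close>

text \<open>
  The enumeration of the coordinates turns \<open>j < k\<close> into \<open>\<beta>\<^sub>j \<noteq> 0\<close>. A kernel vector of the leading block
  of \<open>S\<close> gives an active null direction, so \<open>active_definite\<close> makes the block invertible, and its
  inverse applied to \<open>r x\<^sub>0 - g\<close> and to \<open>x\<^sub>0\<close> yields the vectors \<open>v\<close> and \<open>u\<close> of \<open>lasso_influence\<close>.
\<close>

theorem proposition5p3:
  fixes M :: "'a measure"
    and x :: "'a \<Rightarrow> real ^ 'p" and e y :: "'a \<Rightarrow> real"
    and \<beta>\<^sub>0 \<beta> x\<^sub>0 :: "real ^ 'p" and \<sigma> lam y\<^sub>0 :: real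
    and H\<^sub>0 :: "((real ^ 'p) \<times> real) measure"
    and c :: "nat \<Rightarrow> 'p" and k :: nat
  assumes "prob_space M"
    and "x \<in> borel_measurable M" and "e \<in> borel_measurable M"
    and model: "y = (\<lambda>\<omega>. x \<omega> \<bullet> \<beta>\<^sub>0 + e \<omega>)"
    and indep: "prob_space.indep_set M {x -` A \<inter> space M |A. A \<in> sets borel}
                                         {e -` A \<inter> space M |A. A \<in> sets borel}"
    and x_moment: "integrable M (\<lambda>\<omega>. (norm (x \<omega>))\<^sup>2)"
    and e_moment: "integrable M (\<lambda>\<omega>. (e \<omega>)\<^sup>2)"
    and centered: "prob_space.expectation M e = 0"
    and symmetric: "distr M borel e = distr M borel (\<lambda>\<omega>. - e \<omega>)"
    and variance: "prob_space.variance M e = \<sigma>\<^sup>2"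
    and H0: "H\<^sub>0 = distr M borel (\<lambda>\<omega>. (x \<omega>, y \<omega>))"
    and "lam \<ge> 0"
    and unique: "\<exists>!b. is_arg_min (lasso_objective lam H\<^sub>0) (\<lambda>_. True) b"
    and \<beta>: "\<beta> = lasso lam H\<^sub>0"
    and c: "bij_betw c {..<CARD('p)} UNIV"
    and "k \<le> CARD('p)"
    and nonzero: "\<And>j. j < k \<Longrightarrow> \<beta> $ c j \<noteq> 0"
    and zero: "\<And>j. k \<le> j \<Longrightarrow> j < CARD('p) \<Longrightarrow> \<beta> $ c j = 0"
    and strict: "\<And>j. k \<le> j \<Longrightarrow> j < CARD('p) \<Longrightarrow>
                   \<bar>\<integral>z. fst z $ c j * (snd z - fst z \<bullet> \<beta>) \<partial>H\<^sub>0\<bar> < lam"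
  shows "\<exists>B \<in> carrier_mat k k.
           inverts_mat (head_second_moment c k H\<^sub>0) B \<and>
           inverts_mat B (head_second_moment c k H\<^sub>0) \<and>
           has_influence_function (lasso lam) H\<^sub>0 (x\<^sub>0, y\<^sub>0)
             (pad c k (B *\<^sub>v
               ((y\<^sub>0 - x\<^sub>0 \<bullet> \<beta>) \<cdot>\<^sub>v head c k x\<^sub>0 - head_score c k H\<^sub>0 \<beta>)))"
proof -
  have enum: "\<exists>j<CARD('p). i = c j" for i
    using c unfolding bij_betw_def by (metis UNIV_I imageE lessThan_iff)
  have xy: "(\<lambda>\<omega>. (x \<omega>, y \<omega>)) \<in> borel_measurable M"
    using assms(2,3) unfolding model by measurable
  have H: "square_integrable_model H\<^sub>0"
  proof -
    have meas: "(\<lambda>z::(real^'p) \<times> real. (norm (fst z))\<^sup>2) \<in> borel_measurable borel"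
      "(\<lambda>z::(real^'p) \<times> real. (snd z)\<^sup>2) \<in> borel_measurable borel"
      by (intro borel_measurable_continuous_onI continuous_intros)+
    have "integrable M (\<lambda>\<omega>. (y \<omega>)\<^sup>2)"
    proof (rule Bochner_Integration.integrable_bound)
      show "integrable M (\<lambda>\<omega>. 2 * (norm \<beta>\<^sub>0)\<^sup>2 * (norm (x \<omega>))\<^sup>2 + 2 * (e \<omega>)\<^sup>2)"
        using x_moment e_moment by simp
      show "(\<lambda>\<omega>. (y \<omega>)\<^sup>2) \<in> borel_measurable M"
        using assms(2,3) unfolding model by measurable
      have "(X \<bullet> \<beta>\<^sub>0 + r)\<^sup>2 \<le> 2 * (norm \<beta>\<^sub>0)\<^sup>2 * (norm X)\<^sup>2 + 2 * r\<^sup>2" for X and r :: real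
        using affine_sq_le[of 1 r X \<beta>\<^sub>0] by (simp add: add.commute)
      then show "AE \<omega> in M. norm ((y \<omega>)\<^sup>2)
          \<le> norm (2 * (norm \<beta>\<^sub>0)\<^sup>2 * (norm (x \<omega>))\<^sup>2 + 2 * (e \<omega>)\<^sup>2)"
        by (intro AE_I2) (simp add: model)
    qed
    with x_moment show ?thesis
      unfolding square_integrable_model_def H0
      by (simp add: integrable_distr_eq[OF xy meas(1)] integrable_distr_eq[OF xy meas(2)])
  qed
  have min: "lasso_objective lam H\<^sub>0 \<beta> \<le> lasso_objective lam H\<^sub>0 b'"
    and uniq: "lasso_objective lam H\<^sub>0 b' = lasso_objective lam H\<^sub>0 \<beta> \<Longrightarrow> b' = \<beta>" for b'
  proof -
    have "is_arg_min (lasso_objective lam H\<^sub>0) (\<lambda>_. True) \<beta>"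
      unfolding \<beta> lasso_def arg_min_def using unique by (metis someI)
    then have m: "lasso_objective lam H\<^sub>0 \<beta> \<le> lasso_objective lam H\<^sub>0 b'" for b'
      by (simp add: is_arg_min_linorder)
    show "lasso_objective lam H\<^sub>0 \<beta> \<le> lasso_objective lam H\<^sub>0 b'" by (rule m)
    show "b' = \<beta>" if "lasso_objective lam H\<^sub>0 b' = lasso_objective lam H\<^sub>0 \<beta>"
      using unique m that by (auto simp: is_arg_min_linorder)
  qed
  have active: "\<beta> $ c j \<noteq> 0 \<longleftrightarrow> j < k" if "j < CARD('p)" for j
    using nonzero[of j] zero[of j] that by (cases "j < k") auto
  let ?G = "head_second_moment c k H\<^sub>0"
  have G: "?G \<in> carrier_mat k k" by (simp add: head_second_moment_def)
  have pad_supp: "pad c k w $ j = 0" if "\<beta> $ j = 0" for w j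
    using enum[of j] that active pad_nth[OF c \<open>k \<le> CARD('p)\<close>] by metis
  have pad_moment: "second_moment H\<^sub>0 (pad c k w) $ j = z $ j"
    if "w \<in> carrier_vec k" "?G *\<^sub>v w = head c k z" "\<beta> $ j \<noteq> 0" for w j z
  proof -
    have "\<exists>i<k. j = c i" using enum[of j] active that(3) by auto
    then obtain i where i: "i < k" "j = c i" by blast
    then show ?thesis using second_moment_pad[OF H i(1) that(1), of c] that(2) by (simp add: head_def)
  qed
  have ker: "w = 0\<^sub>v k" if w: "w \<in> carrier_vec k" "?G *\<^sub>v w = 0\<^sub>v k" for w
  proof -
    let ?h = "pad c k w"
    have "?G *\<^sub>v w = head c k 0" using w(2) by (auto simp: head_def)
    then have "?h $ j * second_moment H\<^sub>0 ?h $ j = 0" for j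
      using pad_supp[of j w] pad_moment[OF w(1), of 0 j] by (cases "\<beta> $ j = 0") auto
    then have "?h \<bullet> second_moment H\<^sub>0 ?h = 0" by (simp only: inner_vec_def inner_real_def sum.neutral_const)
    then have "(\<integral>z. (fst z \<bullet> ?h)\<^sup>2 \<partial>H\<^sub>0) = 0" by (simp add: inner_second_moment[OF H] power2_eq_square)
    then have "?h = 0" using active_definite[OF H min uniq pad_supp] by blast
    show "w = 0\<^sub>v k"
    proof (rule eq_vecI)
      show "vec_index w i = vec_index (0\<^sub>v k) i" if "i < dim_vec (0\<^sub>v k)" for i
        using that pad_nth[OF c \<open>k \<le> CARD('p)\<close>, of i w] \<open>?h = 0\<close> \<open>k \<le> CARD('p)\<close> by simp
    qed (use w in simp)
  qed
  obtain B where B: "B \<in> carrier_mat k k" "inverts_mat ?G B" "inverts_mat B ?G"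
    using inverts_mat_of_trivial_kernel[OF G ker] .
  have solve: "?G *\<^sub>v (B *\<^sub>v r) = r" if "r \<in> carrier_vec k" for r
  proof -
    have "?G *\<^sub>v (B *\<^sub>v r) = (?G * B) *\<^sub>v r" using G B(1) that by (simp add: assoc_mult_mat_vec)
    then show ?thesis using B(2) G that by (simp add: inverts_mat_def)
  qed
  let ?r = "(y\<^sub>0 - x\<^sub>0 \<bullet> \<beta>) \<cdot>\<^sub>v head c k x\<^sub>0 - head_score c k H\<^sub>0 \<beta>"
  have r: "?r = head c k ((y\<^sub>0 - x\<^sub>0 \<bullet> \<beta>) *\<^sub>R x\<^sub>0 - score H\<^sub>0 \<beta>)"
    by (rule eq_vecI) (auto simp: head_def head_score_def score_def)
  have hd: "head c k z \<in> carrier_vec k" for z by (simp add: head_def)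
  have "has_influence_function (lasso lam) H\<^sub>0 (x\<^sub>0, y\<^sub>0) (pad c k (B *\<^sub>v ?r))"
  proof (rule lasso_influence[OF H \<open>lam \<ge> 0\<close> min uniq])
    show "\<bar>score H\<^sub>0 \<beta> $ j\<bar> < lam" if "\<beta> $ j = 0" for j
      using enum[of j] active strict that by (auto simp: score_def not_less[symmetric])
    show "second_moment H\<^sub>0 (pad c k (B *\<^sub>v ?r)) $ j = (y\<^sub>0 - x\<^sub>0 \<bullet> \<beta>) * x\<^sub>0 $ j - score H\<^sub>0 \<beta> $ j"
      if "\<beta> $ j \<noteq> 0" for j
      using pad_moment[OF mult_mat_vec_carrier[OF B(1) hd] solve[OF hd] that]
      by (simp add: r)
    show "second_moment H\<^sub>0 (pad c k (B *\<^sub>v head c k x\<^sub>0)) $ j = x\<^sub>0 $ j" if "\<beta> $ j \<noteq> 0" for j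
      using pad_moment[OF mult_mat_vec_carrier[OF B(1) hd] solve[OF hd] that] .
  qed (assumption | rule pad_supp, assumption)+
  with B show ?thesis by blast
qed

end
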